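(* Let $\mathcal{H}$ be a $k$-uniform hypergraph. If $s\ge1$ and $r\ge ks$ are integers, then $\mathtt{E}(\mathcal{L}(\mathcal{H}^r_s))=s\,\mathtt{E}(\mathcal{L}(\mathcal{H}))$.
   Context: A hypergraph $\mathcal{H}=(V,E)$ is $k$-uniform ($k\ge2$) if every edge has exactly $k$ vertices. For integers $s\ge1$, $r\ge ks$, the power hypergraph $\mathcal{H}^r_s$ is the $r$-uniform hypergraph obtained by replacing each vertex $v\in V$ by a set $\varsigma_v$ of $s$ new vertices and adding to each edge $e\in E$ a set $\varsigma_e$ of $r-ks$ new vertices (all these sets pairwise disjoint): its edges are $\varsigma_e\cup\varsigma_{v_1}\cup\cdots\cup\varsigma_{v_k}$ for each $e=\{v_1,\dots,v_k\}\in E$. The line multigraph $\mathcal{L}(\mathcal{G})$ of a hypergraph $\mathcal{G}$ has the edges of $\mathcal{G}$ as vertices, with $|e\cap f|$ edges between distinct $e,f$; its adjacency matrix has entry $|e\cap f|$ for $e\neq f$ and $0$ on the diagonal. $\mathtt{E}(\mathcal{L}(\mathcal{G}))$ denotes the sum of the absolute values of the eigenvalues of this adjacency matrix. *)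

theory Defs
  imports "Jordan_Normal_Form.Spectral_Radius"
begin

record 'a hypergraph =
  hverts :: "'a set"
  hedges :: "'a set set"

definition hypergraph :: "'a hypergraph \<Rightarrow> bool" where
  "hypergraph H \<longleftrightarrow> finite (hverts H) \<and> hedges H \<subseteq> Pow (hverts H)"

definition uniform :: "nat \<Rightarrow> 'a hypergraph \<Rightarrow> bool" where
  "uniform k H \<longleftrightarrow> (\<forall>e\<in>hedges H. card e = k)"

text \<open>
  Vertices of a power hypergraph: the copies of a vertex of the base hypergraph, and the
  vertices added to an edge of it. Distinct constructor arguments give distinct vertices,
  which makes all the sets of new vertices pairwise disjoint.
\<close>

datatype 'a power_vertex = VCopy 'a nat | EExtra "'a set" nat

definition vertex_block :: "nat \<Rightarrow> 'a \<Rightarrow> 'a power_vertex set" where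
  "vertex_block s v = VCopy v ` {..<s}"

definition edge_block :: "nat \<Rightarrow> 'a set \<Rightarrow> 'a power_vertex set" where
  "edge_block m e = EExtra e ` {..<m}"

definition power_edge :: "nat \<Rightarrow> nat \<Rightarrow> nat \<Rightarrow> 'a set \<Rightarrow> 'a power_vertex set" where
  "power_edge k s r e = edge_block (r - k * s) e \<union> (\<Union>v\<in>e. vertex_block s v)"

text \<open>The parameter \<open>k\<close> is the uniformity of the base hypergraph.\<close>

definition power_hypergraph ::
    "nat \<Rightarrow> nat \<Rightarrow> nat \<Rightarrow> 'a hypergraph \<Rightarrow> 'a power_vertex hypergraph" where
  "power_hypergraph k s r H =
     \<lparr> hverts = (\<Union>v\<in>hverts H. vertex_block s v) \<union> (\<Union>e\<in>hedges H. edge_block (r - k * s) e),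
       hedges = power_edge k s r ` hedges H \<rparr>"

lemma hypergraph_power_hypergraph:
  assumes "hypergraph H"
  shows "hypergraph (power_hypergraph k s r H)"
proof -
  have "finite (hedges H)"
    using assms unfolding hypergraph_def by (meson finite_Pow_iff finite_subset)
  then show ?thesis
    using assms
    unfolding hypergraph_def power_hypergraph_def power_edge_def vertex_block_def edge_block_def
    by (auto, blast)
qed

lemma uniform_power_hypergraph:
  assumes H: "hypergraph H" and k: "uniform k H" and r: "k * s \<le> r"
  shows "uniform r (power_hypergraph k s r H)"
proof -
  have "card (power_edge k s r e) = r" if e: "e \<in> hedges H" for e
  proof -
    have fin: "finite e"
      using H e unfolding hypergraph_def by (meson PowD finite_subset in_mono)
    have "card (\<Union>v\<in>e. vertex_block s v) = (\<Sum>v\<in>e. card (vertex_block s v))"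
      using fin by (intro card_UN_disjoint) (auto simp: vertex_block_def)
    also have "\<dots> = k * s"
      using k e by (simp add: vertex_block_def card_image inj_on_def uniform_def)
    finally have V: "card (\<Union>v\<in>e. vertex_block s v) = k * s" .
    have E: "card (edge_block (r - k * s) e) = r - k * s"
      by (simp add: edge_block_def card_image inj_on_def)
    have "card (power_edge k s r e)
        = card (edge_block (r - k * s) e) + card (\<Union>v\<in>e. vertex_block s v)"
      unfolding power_edge_def
      using fin by (intro card_Un_disjoint) (auto simp: vertex_block_def edge_block_def)
    then have "card (power_edge k s r e) = (r - k * s) + k * s"
      by (simp add: V E)
    then show ?thesis using r by simp
  qed
  then show ?thesis by (simp add: uniform_def power_hypergraph_def)
qed

text \<open>A multigraph is given by its vertex set and the number of edges between two vertices.\<close>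

record 'v multigraph =
  mverts :: "'v set"
  mult :: "'v \<Rightarrow> 'v \<Rightarrow> nat"

definition line_multigraph :: "'a hypergraph \<Rightarrow> 'a set multigraph" where
  "line_multigraph G =
     \<lparr> mverts = hedges G, mult = (\<lambda>e f. if e = f then 0 else card (e \<inter> f)) \<rparr>"

definition adjacency_matrix :: "'v multigraph \<Rightarrow> 'v list \<Rightarrow> complex mat" where
  "adjacency_matrix M vs =
     mat (length vs) (length vs) (\<lambda>(i, j). of_nat (mult M (vs ! i) (vs ! j)))"

text \<open>
  An arbitrary enumeration of the vertices; another one conjugates the adjacency matrix by a
  permutation matrix and so does not change its eigenvalues.
\<close>

definition vertex_list :: "'v multigraph \<Rightarrow> 'v list" where
  "vertex_list M = (SOME vs. distinct vs \<and> set vs = mverts M)"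

text \<open>
  Eigenvalues are counted with algebraic multiplicity, the order of the root of the
  characteristic polynomial.
\<close>

definition matrix_energy :: "complex mat \<Rightarrow> real" where
  "matrix_energy A = (\<Sum>z\<in>spectrum A. real (order z (char_poly A)) * cmod z)"

definition energy :: "'v multigraph \<Rightarrow> real" where
  "energy M = matrix_energy (adjacency_matrix M (vertex_list M))"

end

theory Submission
  imports Defs
begin

text \<open>
  Distinct edges of the power hypergraph share exactly the copies of the common vertices of the
  edges of the base hypergraph they come from. Hence, up to a simultaneous permutation of rows
  and columns, the adjacency matrix of its line multigraph is \<open>s\<close> times that of the base
  hypergraph, and its eigenvalues are multiplied by \<open>s\<close>.
\<close>

text \<open>An edge can be read off from its power edge: \<open>v\<close> belongs to it exactly when
  the copy \<open>VCopy v 0\<close> is present, and this copy exists since s \<ge> 1.\<close>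

lemma inj_power_edge:
  assumes "1 \<le> s"
  shows "inj (power_edge k s r)"
proof (rule injI)
  fix e f :: "'a set"
  assume eq: "power_edge k s r e = power_edge k s r f"
  have mem: "v \<in> g \<longleftrightarrow> VCopy v 0 \<in> power_edge k s r g" for v and g :: "'a set"
    using assms by (auto simp: power_edge_def vertex_block_def edge_block_def image_iff)
  show "e = f"
    using eq by (auto simp: mem)
qed

text \<open>The extra vertices carry their edge as a tag, so those of distinct edges never meet;
  what remains is one block of \<open>s\<close> copies for each common vertex.\<close>

lemma card_power_edge_Int:
  assumes "finite e" and "e \<noteq> f"
  shows "card (power_edge k s r e \<inter> power_edge k s r f) = s * card (e \<inter> f)"
proof -
  have "power_edge k s r e \<inter> power_edge k s r f = (\<Union>v\<in>e \<inter> f. vertex_block s v)"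
    using assms(2) by (auto simp: power_edge_def vertex_block_def edge_block_def)
  moreover have "card (\<Union>v\<in>e \<inter> f. vertex_block s v) = (\<Sum>v\<in>e \<inter> f. card (vertex_block s v))"
    using assms(1) by (intro card_UN_disjoint) (auto simp: vertex_block_def)
  ultimately show ?thesis
    by (simp add: vertex_block_def card_image inj_on_def)
qed

lemma adjacency_matrix_carrier:
  "adjacency_matrix M vs \<in> carrier_mat (length vs) (length vs)"
  by (simp add: adjacency_matrix_def)

lemma adjacency_matrix_power_hypergraph:
  assumes H: "hypergraph H" and s: "1 \<le> s" and vs: "set vs \<subseteq> hedges H"
  shows "adjacency_matrix (line_multigraph (power_hypergraph k s r H)) (map (power_edge k s r) vs)
       = of_nat s \<cdot>\<^sub>m adjacency_matrix (line_multigraph H) vs"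
proof (rule eq_matI)
  fix i j
  assume "i < dim_row (of_nat s \<cdot>\<^sub>m adjacency_matrix (line_multigraph H) vs)"
    and "j < dim_col (of_nat s \<cdot>\<^sub>m adjacency_matrix (line_multigraph H) vs)"
  then have ij: "i < length vs" "j < length vs"
    by (simp_all add: adjacency_matrix_def)
  have "vs ! i \<in> hedges H"
    using ij vs by auto
  then have "finite (vs ! i)"
    using H unfolding hypergraph_def by (meson PowD finite_subset in_mono)
  then show "adjacency_matrix (line_multigraph (power_hypergraph k s r H))
        (map (power_edge k s r) vs) $$ (i, j)
      = (of_nat s \<cdot>\<^sub>m adjacency_matrix (line_multigraph H) vs) $$ (i, j)"
    \<comment> \<open>Injectivity of \<open>power_edge\<close> makes the zero case of
      \<open>mult\<close> occur for the same index pairs on both sides.\<close>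
    using ij by (auto simp: adjacency_matrix_def line_multigraph_def card_power_edge_Int
        inj_eq[OF inj_power_edge[OF s]])
qed (simp_all add: adjacency_matrix_def)

text \<open>Permuting rows and permuting columns each contribute the sign of \<open>p\<close>, and
  the square of the sign is 1. The columns are handled as rows of the transpose.\<close>

lemma det_permute_rows_cols:
  assumes A: "A \<in> carrier_mat n n" and p: "p permutes {0..<n}"
  shows "det (mat n n (\<lambda>(i, j). A $$ (p i, p j))) = det A"
proof -
  define B where "B = mat n n (\<lambda>(i, j). A $$ (p i, j))"
  have B: "B \<in> carrier_mat n n"
    by (simp add: B_def)
  have lt: "p i < n" if "i < n" for i
    using permutes_in_image[OF p, of i] that by simp
  have "mat n n (\<lambda>(i, j). A $$ (p i, p j))
      = transpose_mat (mat n n (\<lambda>(i, j). transpose_mat B $$ (p i, j)))"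
    using lt by (intro eq_matI) (auto simp: B_def)
  then have "det (mat n n (\<lambda>(i, j). A $$ (p i, p j)))
      = det (mat n n (\<lambda>(i, j). transpose_mat B $$ (p i, j)))"
    by (simp add: det_transpose[of _ n])
  also have "\<dots> = signof p * det B"
    using B by (subst det_permute_rows[OF _ p]) (simp_all add: det_transpose[of _ n])
  also have "\<dots> = signof p * (signof p * det A)"
    unfolding B_def by (simp only: det_permute_rows[OF A p])
  also have "\<dots> = det A"
    by (simp add: sign_def)
  finally show ?thesis .
qed

text \<open>As \<open>p\<close> is injective, a simultaneous permutation keeps diagonal entries on
  the diagonal, so it commutes with passing from \<open>A\<close> to xI - A.\<close>

lemma char_poly_permute:
  fixes A :: "'a :: comm_ring_1 mat"
  assumes A: "A \<in> carrier_mat n n" and p: "p permutes {0..<n}"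
  shows "char_poly (mat n n (\<lambda>(i, j). A $$ (p i, p j))) = char_poly A"
proof -
  have lt: "p i < n" if "i < n" for i
    using permutes_in_image[OF p, of i] that by simp
  have "char_poly_matrix (mat n n (\<lambda>(i, j). A $$ (p i, p j)))
      = mat n n (\<lambda>(i, j). char_poly_matrix A $$ (p i, p j))"
    using A lt
    by (intro eq_matI) (auto simp: char_poly_matrix_def inj_eq[OF permutes_inj[OF p]])
  then show ?thesis
    using A by (simp add: char_poly_def det_permute_rows_cols[OF _ p])
qed

lemma char_poly_adjacency_matrix_cong:
  assumes "mset ws = mset vs"
  shows "char_poly (adjacency_matrix M ws) = char_poly (adjacency_matrix M vs)"
proof -
  obtain p where p: "p permutes {..<length vs}" and ws: "permute_list p vs = ws"
    using assms by (rule mset_eq_permutation)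
  have lt: "p i < length vs" if "i < length vs" for i
    using permutes_in_image[OF p, of i] that by simp
  have "adjacency_matrix M ws
      = mat (length vs) (length vs) (\<lambda>(i, j). adjacency_matrix M vs $$ (p i, p j))"
    using lt p unfolding ws[symmetric]
    by (intro eq_matI) (auto simp: adjacency_matrix_def permute_list_nth)
  then show ?thesis
    using char_poly_permute[OF adjacency_matrix_carrier, of p vs M] p
    by (simp add: atLeast0LessThan)
qed

text \<open>Orders add over a product of nonzero polynomials, and each factor contributes 1 exactly
  at its own root.\<close>

lemma order_linear_factors:
  fixes as :: "'a :: idom list"
  shows "Polynomial.order z (\<Prod>a\<leftarrow>as. [:- a, 1:]) = count_list as z"
proof (induction as)
  case (Cons a as)
  have "(\<Prod>a\<leftarrow>as. [:- a, 1:]) \<noteq> 0"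
    by auto
  moreover have "Polynomial.order z [:- a, 1:] = (if a = z then 1 else 0)"
    using order_power_n_n[of a 1] by (auto intro: order_0I)
  ultimately show ?case
    using Cons.IH by (simp add: order_mult del: mult_pCons_left)
qed simp

lemma sum_list_map_eq_sum_of_nat_count:
  fixes f :: "'a \<Rightarrow> 'b :: comm_semiring_1"
  shows "sum_list (map f xs) = (\<Sum>x\<in>set xs. of_nat (count_list xs x) * f x)"
proof -
  \<comment> \<open>The index set is kept fixed while the list varies, so that the induction need
    not ask whether the head occurs again in the tail.\<close>
  have "sum_list (map f ys) = (\<Sum>x\<in>set xs. of_nat (count_list ys x) * f x)"
    if "set ys \<subseteq> set xs" for ys
    using that
  proof (induction ys)
    case (Cons y ys)
    have "(\<Sum>x\<in>set xs. of_nat (count_list (y # ys) x) * f x)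
        = (\<Sum>x\<in>set xs. (if x = y then f x else 0) + of_nat (count_list ys x) * f x)"
      by (rule sum.cong) (auto simp: algebra_simps)
    then show ?case
      using Cons by (simp add: sum.distrib)
  qed simp
  then show ?thesis by simp
qed

text \<open>Passes from a sum over distinct eigenvalues weighted by multiplicity to a sum over the
  list of all roots, which is easy to rescale.\<close>

lemma matrix_energy_linear_factors:
  assumes A: "A \<in> carrier_mat n n" and as: "char_poly A = (\<Prod>a\<leftarrow>as. [:- a, 1:])"
  shows "matrix_energy A = (\<Sum>a\<leftarrow>as. cmod a)"
proof -
  have "spectrum A = set as"
    unfolding spectrum_def
    by (auto simp: eigenvalue_root_char_poly[OF A] as poly_prod_list)
  then show ?thesis
    unfolding matrix_energy_def as order_linear_factors
    by (simp add: sum_list_map_eq_sum_of_nat_count)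
qed

text \<open>Since xI - cA = c((x/c)I - A), the determinant releases one factor \<open>c\<close> per
  row.\<close>

lemma poly_char_poly_smult:
  fixes A :: "'a :: field mat"
  assumes A: "A \<in> carrier_mat n n" and c: "c \<noteq> 0"
  shows "poly (char_poly (c \<cdot>\<^sub>m A)) x = c ^ n * poly (char_poly A) (x / c)"
proof -
  have "- char_matrix (c \<cdot>\<^sub>m A) x = c \<cdot>\<^sub>m (- char_matrix A (x / c))"
    using A c by (intro eq_matI) (auto simp: char_matrix_def field_simps)
  then show ?thesis
    using A by (simp add: char_poly_matrix[of _ n] char_matrix_def)
qed

lemma matrix_energy_smult:
  assumes A: "A \<in> carrier_mat n n" and c: "c \<noteq> 0"
  shows "matrix_energy (c \<cdot>\<^sub>m A) = cmod c * matrix_energy A"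
proof -
  obtain as where as: "char_poly A = (\<Prod>a\<leftarrow>as. [:- a, 1:])" and n: "length as = n"
    using char_poly_factorized[OF A] by blast
  \<comment> \<open>Each linear factor absorbs one power of \<open>c\<close>, because c(x/c - a) = x
    - ca; the roots are thus multiplied by \<open>c\<close>.\<close>
  have scale: "c ^ length bs * poly (\<Prod>a\<leftarrow>bs. [:- a, 1:]) (x / c)
      = poly (\<Prod>a\<leftarrow>map ((*) c) bs. [:- a, 1:]) x" for bs x
    using c by (induction bs) (simp_all add: field_simps)
  have "char_poly (c \<cdot>\<^sub>m A) = (\<Prod>a\<leftarrow>map ((*) c) as. [:- a, 1:])"
    by (rule poly_ext) (simp only: poly_char_poly_smult[OF A c] as n[symmetric] scale)
  then have "matrix_energy (c \<cdot>\<^sub>m A) = (\<Sum>a\<leftarrow>map ((*) c) as. cmod a)"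
    using A by (intro matrix_energy_linear_factors[of _ n]) simp_all
  then show ?thesis
    by (simp add: matrix_energy_linear_factors[OF A as] o_def norm_mult sum_list_const_mult)
qed

lemma matrix_energy_cong_char_poly:
  assumes A: "A \<in> carrier_mat n n" and B: "B \<in> carrier_mat n n" and "char_poly A = char_poly B"
  shows "matrix_energy A = matrix_energy B"
proof -
  have "spectrum A = spectrum B"
    unfolding spectrum_def using assms(3)
    by (auto simp: eigenvalue_root_char_poly[OF A] eigenvalue_root_char_poly[OF B])
  then show ?thesis
    using assms(3) by (simp add: matrix_energy_def)
qed

text \<open>Frees the energy from the choice made in \<open>vertex_list\<close>: two enumerations
  without repetition have the same multiset, hence matrices with the same characteristic
  polynomial.\<close>

lemma energy_eq_matrix_energy:
  assumes vs: "distinct vs" "set vs = mverts M"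
  shows "energy M = matrix_energy (adjacency_matrix M vs)"
proof -
  have "distinct (vertex_list M) \<and> set (vertex_list M) = mverts M"
    unfolding vertex_list_def by (rule someI[of _ vs]) (use vs in simp)
  then have mset: "mset (vertex_list M) = mset vs"
    using vs by (simp add: set_eq_iff_mset_eq_distinct[symmetric])
  then have "length (vertex_list M) = length vs"
    by (rule mset_eq_length)
  then show ?thesis
    unfolding energy_def
    by (metis matrix_energy_cong_char_poly adjacency_matrix_carrier
        char_poly_adjacency_matrix_cong[OF mset])
qed

theorem theorem31:
  fixes H :: "'a hypergraph" and k s r :: nat
  assumes "hypergraph H" and "2 \<le> k" and "uniform k H"
    and "1 \<le> s" and "k * s \<le> r"
  shows "energy (line_multigraph (power_hypergraph k s r H)) = real s * energy (line_multigraph H)"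
proof -
  have "finite (hedges H)"
    using assms(1) unfolding hypergraph_def by (meson finite_Pow_iff finite_subset)
  then obtain vs where vs: "distinct vs" "set vs = hedges H"
    using finite_distinct_list by blast
  let ?A = "adjacency_matrix (line_multigraph H) vs"
  \<comment> \<open>Listing the power edges in the order of \<open>vs\<close> aligns the two
    matrices entry by entry.\<close>
  have "energy (line_multigraph (power_hypergraph k s r H))
      = matrix_energy (adjacency_matrix (line_multigraph (power_hypergraph k s r H))
          (map (power_edge k s r) vs))"
    using vs inj_on_subset[OF inj_power_edge[OF assms(4)] subset_UNIV]
    by (intro energy_eq_matrix_energy)
      (simp_all add: distinct_map line_multigraph_def power_hypergraph_def)
  also have "\<dots> = matrix_energy (of_nat s \<cdot>\<^sub>m ?A)"
    using vs assms by (simp add: adjacency_matrix_power_hypergraph)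
  also have "\<dots> = real s * matrix_energy ?A"
    using assms(4) by (subst matrix_energy_smult[OF adjacency_matrix_carrier]) simp_all
  also have "matrix_energy ?A = energy (line_multigraph H)"
    using vs by (intro energy_eq_matrix_energy[symmetric]) (simp_all add: line_multigraph_def)
  finally show ?thesis .
qed

end
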